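(* Let $D$ be a digraph on $\{1,\dots,n\}$. Then $$\lim_{q\to\infty}\frac{1}{|F[D,q]|}\sum_{f\in F[D,q]}\operatorname{ima}(f)=\alpha_1(D).$$
   Context: A digraph $D=(V,E)$ has $V=\{1,\dots,n\}$, $E\subseteq V^2$ (loops allowed). Two arcs $(u,v),(u',v')$ are independent if $u\ne u'$ and $v\ne v'$; $\alpha_1(D)$ is the maximum number of pairwise independent arcs. With $[q]=\{0,\dots,q-1\}$, for $f:[q]^n\to[q]^n$, $\mathrm{IG}(f)$ is the digraph on $V$ with $(u,v)$ an arc iff $f_v$ depends essentially on $x_u$; $F[D,q]=\{f:[q]^n\to[q]^n:\mathrm{IG}(f)=D\}$. $\operatorname{ima}(f)=\log_q|\mathrm{Im}(f)|$. *)

theory Defs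
  imports
    Complex_Main
    "HOL-Library.FuncSet"
    "Graph_Theory.Pair_Digraph"
begin

definition independent_arcs :: "nat \<times> nat \<Rightarrow> nat \<times> nat \<Rightarrow> bool" where
  "independent_arcs a b \<longleftrightarrow> fst a \<noteq> fst b \<and> snd a \<noteq> snd b"

(* Max is taken over a finite nonempty set whenever the digraph has finitely many arcs. *)
definition alpha1 :: "nat pair_pre_digraph \<Rightarrow> nat" where
  "alpha1 D = Max {card A | A. A \<subseteq> parcs D \<and> pairwise independent_arcs A}"

(* [q]^n, with coordinates indexed by 1, ..., n.  Its elements are extensional, i.e. they take
   the value undefined outside {1..n}, so equality of elements is coordinatewise equality. *)
definition configs :: "nat \<Rightarrow> nat \<Rightarrow> (nat \<Rightarrow> nat) set" where
  "configs n q = {1..n} \<rightarrow>\<^sub>E {..<q}"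

definition depends_essentially ::
    "nat \<Rightarrow> nat \<Rightarrow> ((nat \<Rightarrow> nat) \<Rightarrow> nat \<Rightarrow> nat) \<Rightarrow> nat \<Rightarrow> nat \<Rightarrow> bool" where
  "depends_essentially n q f v u \<longleftrightarrow>
     (\<exists>x\<in>configs n q. \<exists>y\<in>configs n q. (\<forall>w\<in>{1..n} - {u}. x w = y w) \<and> f x v \<noteq> f y v)"

definition interaction_graph ::
    "nat \<Rightarrow> nat \<Rightarrow> ((nat \<Rightarrow> nat) \<Rightarrow> nat \<Rightarrow> nat) \<Rightarrow> nat pair_pre_digraph" where
  "interaction_graph n q f =
     \<lparr>pverts = {1..n},
      parcs = {(u, v). u \<in> {1..n} \<and> v \<in> {1..n} \<and> depends_essentially n q f v u}\<rparr>"

(* F[D,q]; n is the number of vertices of D.  The outer extensional function space makes the set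
   finite, with each function [q]^n -> [q]^n represented exactly once. *)
definition functions_with_graph ::
    "nat \<Rightarrow> nat pair_pre_digraph \<Rightarrow> nat \<Rightarrow> ((nat \<Rightarrow> nat) \<Rightarrow> nat \<Rightarrow> nat) set" where
  "functions_with_graph n D q =
     {f \<in> configs n q \<rightarrow>\<^sub>E configs n q. interaction_graph n q f = D}"

definition ima :: "nat \<Rightarrow> nat \<Rightarrow> ((nat \<Rightarrow> nat) \<Rightarrow> nat \<Rightarrow> nat) \<Rightarrow> real" where
  "ima n q f = log (real q) (real (card (f ` configs n q)))"

end

(* Upper bound, for every f: by Koenig's theorem the arcs are covered by a set A of tails and a
   set B of heads with |A| + |B| = alpha_1(D). Coordinates of f outside B only depend on inputs
   in A, so f(x) is determined by x on A and f(x) on B, and |Im f| <= q^alpha_1.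

   Lower bound, on average: let k = alpha_1(D), fix k independent arcs (u_i, v_i), and let only
   the inputs x_{u_i} vary. If x and y differ at u_i, then changing f_{v_i} at x shows that a
   fraction at most 1/(q - n) of F[D,q] satisfies f_{v_i}(x) = f_{v_i}(y), and these savings
   multiply over i. Hence the expected number of pairs with f(x) = f(y) is at most (3q)^k. By
   Cauchy-Schwarz |Im f| >= q^(2k) / #collisions, and concavity of the logarithm gives a mean
   of ima at least k - k log_q 3. *)

theory Submission
  imports Defs "HOL-Analysis.Convex"
begin

subsection \<open>Vertex covers and independent arcs\<close>

text \<open>This is a vertex cover of the bipartite graph of tails and heads, so a vertex of the
  digraph counts once on each side. Finiteness matters because \<open>card\<close> is 0 on infinite
  sets.\<close>

definition arc_cover :: "'a set \<Rightarrow> 'b set \<Rightarrow> ('a \<times> 'b) set \<Rightarrow> bool" where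
  "arc_cover A B E \<longleftrightarrow> finite A \<and> finite B \<and> (\<forall>(a, b)\<in>E. a \<in> A \<or> b \<in> B)"

text \<open>If one of \<open>A1\<close>, \<open>A2\<close> contains \<open>u\<close>, that cover
  already covers its deleted arc. Otherwise the two covers recombine into two covers of
  \<open>E\<close> of total size at most 2(k - 1) + 1, so one of them has size below
  \<open>k\<close>.\<close>

lemma arc_cover_uncross:
  assumes "arc_cover A1 B1 (E - {(u, v)})" "arc_cover A2 B2 (E - {(u, w)})"
    and "(u, v) \<in> E" "(u, w) \<in> E" "v \<noteq> w"
    and less: "card A1 + card B1 < k" "card A2 + card B2 < k"
  shows "\<exists>A B. arc_cover A B E \<and> card A + card B < k"
proof (cases "u \<in> A1 \<or> u \<in> A2")
  case True
  then have "arc_cover A1 B1 E \<or> arc_cover A2 B2 E"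
    using assms by (auto simp: arc_cover_def)
  then show ?thesis using less by blast
next
  case False
  let ?L = "insert u (A1 \<union> A2)"
  have fin: "finite A1" "finite A2" "finite B1" "finite B2"
    using assms by (auto simp: arc_cover_def)
  \<comment> \<open>The new vertex \<open>u\<close> takes care of both deleted arcs; any other arc
    is covered by both given covers.\<close>
  have L: "arc_cover ?L (B1 \<inter> B2) E"
    using assms(1,2) by (fastforce simp: arc_cover_def)
  \<comment> \<open>Each cover must still cover the arc deleted for the other one. As
    \<open>u\<close> is in neither \<open>A1\<close> nor \<open>A2\<close>, this forces
    \<open>w\<close> into \<open>B1\<close> and \<open>v\<close> into \<open>B2\<close>.\<close>
  have R: "arc_cover (A1 \<inter> A2) (B1 \<union> B2) E"
    using assms(1-5) False by (fastforce simp: arc_cover_def)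
  have "card ?L \<le> Suc (card (A1 \<union> A2))"
    by (rule card_insert_le_m1) auto
  moreover have "card (A1 \<union> A2) + card (A1 \<inter> A2) = card A1 + card A2"
    "card (B1 \<union> B2) + card (B1 \<inter> B2) = card B1 + card B2"
    using card_Un_Int[of A1 A2] card_Un_Int[of B1 B2] fin by auto
  ultimately have "card ?L + card (B1 \<inter> B2) < k \<or> card (A1 \<inter> A2) + card (B1 \<union> B2) < k"
    using less by linarith
  then show ?thesis using L R by blast
qed

lemma arc_cover_swap: "arc_cover B A (prod.swap ` E) \<longleftrightarrow> arc_cover A B E"
  by (auto simp: arc_cover_def)

text \<open>Arcs are deleted as long as every cover keeps size at least \<open>k\<close>. Once every
  arc is critical, uncrossing forbids two arcs with a common tail or a common head, so the remaining
  arcs are independent.\<close>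

lemma koenig:
  assumes "finite E" and "\<And>A B. arc_cover A B E \<Longrightarrow> k \<le> card A + card B"
  shows "\<exists>M\<subseteq>E. pairwise independent_arcs M \<and> k \<le> card M"
  using assms
proof (induction E rule: finite_psubset_induct)
  case (psubset E)
  show ?case
  proof (cases "\<exists>e\<in>E. \<forall>A B. arc_cover A B (E - {e}) \<longrightarrow> k \<le> card A + card B")
    case True
    then obtain e where e: "e \<in> E" "\<And>A B. arc_cover A B (E - {e}) \<Longrightarrow> k \<le> card A + card B"
      by blast
    have "\<exists>M\<subseteq>E - {e}. pairwise independent_arcs M \<and> k \<le> card M"
      by (rule psubset.IH) (use e in auto)
    then show ?thesis by blast
  next
    case False
    have small: "\<exists>A B. arc_cover A B (E - {e}) \<and> card A + card B < k" if "e \<in> E" for e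
      using False that by (meson not_le)
    have left: "v = w" if E: "(u, v) \<in> E" "(u, w) \<in> E" for u v w
    proof (rule ccontr)
      assume "v \<noteq> w"
      then have "\<exists>A B. arc_cover A B E \<and> card A + card B < k"
        using small[OF E(1)] small[OF E(2)] arc_cover_uncross[OF _ _ E] by blast
      then show False using psubset.prems by (meson not_le)
    qed
    have right: "v = w" if E: "(v, u) \<in> E" "(w, u) \<in> E" for u v w
    proof (rule ccontr)
      assume "v \<noteq> w"
      \<comment> \<open>Uncrossing is stated for a common tail; reversing all arcs transfers it to a
        common head.\<close>
      have sw: "\<exists>A B. arc_cover A B (prod.swap ` E - {(u, x)}) \<and> card A + card B < k"
        if E': "(x, u) \<in> E" for x
      proof -
        obtain A B where "arc_cover A B (E - {(x, u)})" "card A + card B < k"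
          using small[OF E'] by blast
        moreover have "prod.swap ` (E - {(x, u)}) = prod.swap ` E - {(u, x)}"
          by (auto simp: image_iff)
        ultimately show ?thesis
          by (metis add.commute arc_cover_swap)
      qed
      have "(u, v) \<in> prod.swap ` E" "(u, w) \<in> prod.swap ` E"
        using E by (force simp: image_iff)+
      then have "\<exists>A B. arc_cover A B (prod.swap ` E) \<and> card A + card B < k"
        using sw[OF E(1)] sw[OF E(2)] arc_cover_uncross[where E = "prod.swap ` E"] \<open>v \<noteq> w\<close>
        by blast
      then show False using psubset.prems arc_cover_swap by (metis add.commute not_le)
    qed
    have "pairwise independent_arcs E"
      using left right by (auto simp: pairwise_def independent_arcs_def)
    \<comment> \<open>The set of all tails is itself a cover, so there are at least \<open>k\<close>
      tails and hence at least \<open>k\<close> arcs.\<close>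
    moreover have "arc_cover (fst ` E) {} E"
      using psubset.hyps by (force simp: arc_cover_def)
    then have "k \<le> card (fst ` E)" using psubset.prems by force
    then have "k \<le> card E" using card_image_le[OF psubset.hyps, of fst] by linarith
    ultimately show ?thesis by blast
  qed
qed

lemma alpha1_attained:
  assumes "finite (parcs D)"
  obtains M where "M \<subseteq> parcs D" "pairwise independent_arcs M" "card M = alpha1 D"
proof -
  let ?S = "{card A |A. A \<subseteq> parcs D \<and> pairwise independent_arcs A}"
  have "?S \<subseteq> card ` Pow (parcs D)" by auto
  then have "finite ?S" using assms by (meson finite_Pow_iff finite_imageI finite_subset)
  moreover have "?S \<noteq> {}" by (auto intro!: exI[of _ "{}"])
  ultimately have "alpha1 D \<in> ?S" unfolding alpha1_def by (rule Max_in)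
  then show ?thesis using that by auto
qed

lemma card_le_alpha1:
  assumes "finite (parcs D)" "M \<subseteq> parcs D" "pairwise independent_arcs M"
  shows "card M \<le> alpha1 D"
proof -
  let ?S = "{card A |A. A \<subseteq> parcs D \<and> pairwise independent_arcs A}"
  have "?S \<subseteq> card ` Pow (parcs D)" by auto
  then have "finite ?S" using assms(1) by (meson finite_Pow_iff finite_imageI finite_subset)
  then show ?thesis unfolding alpha1_def using assms by (intro Max_ge) auto
qed

lemma alpha1_cover:
  assumes "finite (parcs D)"
  shows "\<exists>A B. arc_cover A B (parcs D) \<and> card A + card B \<le> alpha1 D"
proof (rule ccontr)
  assume "\<not> ?thesis"
  then have "Suc (alpha1 D) \<le> card A + card B" if "arc_cover A B (parcs D)" for A B
    using that by (meson not_less_eq_eq)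
  then obtain M where "M \<subseteq> parcs D" "pairwise independent_arcs M" "Suc (alpha1 D) \<le> card M"
    using koenig[OF assms] by blast
  then show False using card_le_alpha1[OF assms] by (metis not_less_eq_eq)
qed

subsection \<open>Functions with a given interaction graph\<close>

lemma finite_configs [simp]: "finite (configs n q)"
  by (simp add: configs_def finite_PiE)

lemma finite_functions_with_graph [simp]: "finite (functions_with_graph n D q)"
  by (rule finite_subset[of _ "configs n q \<rightarrow>\<^sub>E configs n q"])
    (auto simp: functions_with_graph_def finite_PiE)

text \<open>Essential dependence only speaks of changes in a single coordinate. Passing from
  \<open>x\<close> to \<open>y\<close> one coordinate at a time changes only inputs that are not
  in-neighbours of \<open>v\<close>, and none of these changes affects coordinate
  \<open>v\<close>.\<close>

lemma functions_with_graph_cong: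
  assumes f: "f \<in> functions_with_graph n D q" and x: "x \<in> configs n q" and y: "y \<in> configs n q"
    and v: "v \<in> {1..n}" and eq: "\<And>u. (u, v) \<in> parcs D \<Longrightarrow> x u = y u"
  shows "f x v = f y v"
proof -
  have D: "parcs D = {(u, v). u \<in> {1..n} \<and> v \<in> {1..n} \<and> depends_essentially n q f v u}"
    using f by (auto simp: functions_with_graph_def interaction_graph_def)
  have hybrid: "f (override_on x y W) v = f x v"
    if "finite W" "W \<subseteq> {1..n}" "\<And>w. w \<in> W \<Longrightarrow> (w, v) \<notin> parcs D" for W
    using that
  proof (induction W)
    case empty
    then show ?case by simp
  next
    case (insert w W)
    have in_c: "override_on x y W' \<in> configs n q" for W'
      using x y by (auto simp: configs_def override_on_def PiE_iff extensional_def)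
    have "\<not> depends_essentially n q f v w"
      using insert.prems v D by auto
    moreover have "\<forall>i\<in>{1..n} - {w}. override_on x y (insert w W) i = override_on x y W i"
      by (simp add: override_on_def)
    ultimately have "f (override_on x y (insert w W)) v = f (override_on x y W) v"
      unfolding depends_essentially_def using in_c by blast
    then show ?case using insert by simp
  qed
  have "f (override_on x y {w\<in>{1..n}. x w \<noteq> y w}) v = f x v"
    by (rule hybrid) (simp, blast, (use eq in blast))
  moreover have "override_on x y {w\<in>{1..n}. x w \<noteq> y w} = y"
    using x y by (auto simp: configs_def override_on_def PiE_iff extensional_def fun_eq_iff)
  ultimately show ?thesis by simp
qed

lemma parcs_subset:
  fixes D :: "nat pair_pre_digraph"
  assumes "pair_wf_digraph D" "pverts D = {1..n}"
  shows "parcs D \<subseteq> {1..n} \<times> {1..n}"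
proof
  fix e assume "e \<in> parcs D"
  then have "fst e \<in> pverts D" "snd e \<in> pverts D"
    using pair_wf_digraph.arc_fst_in_verts[OF assms(1)] pair_wf_digraph.arc_snd_in_verts[OF assms(1)]
    by blast+
  then show "e \<in> {1..n} \<times> {1..n}" using assms(2) by (cases e) simp
qed

lemma finite_parcs:
  fixes D :: "nat pair_pre_digraph"
  assumes "pair_wf_digraph D" "pverts D = {1..n}"
  shows "finite (parcs D)"
  by (rule finite_subset[OF parcs_subset[OF assms]]) simp

lemma interaction_graph_eqI:
  assumes "pair_wf_digraph D" "pverts D = {1..n}"
    and "\<And>u v. u \<in> {1..n} \<Longrightarrow> v \<in> {1..n} \<Longrightarrow> depends_essentially n q f v u \<longleftrightarrow> (u, v) \<in> parcs D"
  shows "interaction_graph n q f = D"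
proof (rule pair_pre_digraph.equality)
  show "parcs (interaction_graph n q f) = parcs D"
    using parcs_subset[OF assms(1,2)] assms(3) unfolding interaction_graph_def by auto
qed (use assms(2) in \<open>simp_all add: interaction_graph_def\<close>)

text \<open>This keeps the average from dividing by zero. The witness is, in each coordinate
  \<open>v\<close>, the indicator that all in-neighbours of \<open>v\<close> are 0.\<close>

lemma functions_with_graph_nonempty:
  assumes D: "pair_wf_digraph D" "pverts D = {1..n}" and q: "2 \<le> q"
  shows "functions_with_graph n D q \<noteq> {}"
proof -
  define f where "f = (\<lambda>x\<in>configs n q. \<lambda>v\<in>{1..n}.
    if \<forall>u. (u, v) \<in> parcs D \<longrightarrow> x u = 0 then 1 else 0 :: nat)"
  have N: "u \<in> {1..n}" if "(u, v) \<in> parcs D" for u v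
    using that parcs_subset[OF D] by blast
  have "depends_essentially n q f v u \<longleftrightarrow> (u, v) \<in> parcs D" if uv: "u \<in> {1..n}" "v \<in> {1..n}" for u v
  proof
    assume "(u, v) \<in> parcs D"
    let ?x = "\<lambda>i\<in>{1..n}. 0 :: nat" and ?y = "\<lambda>i\<in>{1..n}. if i = u then 1 else 0 :: nat"
    have xy: "?x \<in> configs n q" "?y \<in> configs n q"
      using q by (auto simp: configs_def)
    moreover have "f ?x v = 1" using xy(1) uv N by (auto simp: f_def)
    moreover have "f ?y v = 0"
      using xy(2) uv \<open>(u, v) \<in> parcs D\<close> by (auto simp: f_def)
    ultimately show "depends_essentially n q f v u"
      unfolding depends_essentially_def
      by (intro bexI[of _ ?x] bexI[of _ ?y]) auto
  next
    assume "depends_essentially n q f v u"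
    then obtain x y where xy: "x \<in> configs n q" "y \<in> configs n q"
      "\<And>w. w \<in> {1..n} \<Longrightarrow> w \<noteq> u \<Longrightarrow> x w = y w" "f x v \<noteq> f y v"
      unfolding depends_essentially_def by blast
    show "(u, v) \<in> parcs D"
    proof (rule ccontr)
      assume "(u, v) \<notin> parcs D"
      then have "x w = y w" if "(w, v) \<in> parcs D" for w
        using that N xy(3) by metis
      then have "f x v = f y v" using xy(1,2) uv by (simp add: f_def)
      then show False using xy(4) by simp
    qed
  qed
  then have "interaction_graph n q f = D" using D by (intro interaction_graph_eqI)
  moreover have "f \<in> configs n q \<rightarrow>\<^sub>E configs n q"
    using q by (auto simp: f_def configs_def)
  ultimately show ?thesis by (auto simp: functions_with_graph_def)
qed

subsection \<open>The upper bound\<close>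

text \<open>A coordinate outside \<open>B\<close> has all its in-neighbours in \<open>A\<close>.
  Hence \<open>G\<close> decodes \<open>f x\<close> from the inputs on \<open>A\<close> and the
  outputs on \<open>B\<close>.\<close>

lemma card_image_le_cover:
  assumes D: "pair_wf_digraph D" "pverts D = {1..n}" and q: "0 < q"
    and f: "f \<in> functions_with_graph n D q" and cov: "arc_cover A B (parcs D)"
  shows "card (f ` configs n q) \<le> q ^ (card A + card B)"
proof -
  have fin: "finite A" "finite B" using cov by (auto simp: arc_cover_def)
  define ext where "ext = (\<lambda>a. \<lambda>i\<in>{1..n}. if i \<in> A then a i else 0 :: nat)"
  define G where "G = (\<lambda>(a, b). \<lambda>v\<in>{1..n}. if v \<in> B then b v else f (ext a) v)"
  let ?P = "A \<rightarrow>\<^sub>E {..<q}" and ?Q = "B \<rightarrow>\<^sub>E {..<q}"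
  have "f ` configs n q \<subseteq> G ` (?P \<times> ?Q)"
  proof
    fix z assume "z \<in> f ` configs n q"
    then obtain x where x: "x \<in> configs n q" "z = f x" by auto
    have z: "z \<in> configs n q"
      using f x by (auto simp: functions_with_graph_def)
    \<comment> \<open>A cover may contain numbers outside \<open>{1..n}\<close>; there the default 0
      keeps \<open>a\<close> and \<open>b\<close> in the range below \<open>q\<close>.\<close>
    define a where "a = (\<lambda>i\<in>A. if i \<in> {1..n} then x i else 0)"
    define b where "b = (\<lambda>i\<in>B. if i \<in> {1..n} then z i else 0)"
    have ab: "a \<in> ?P" "b \<in> ?Q"
      using x(1) z q by (auto simp: a_def b_def configs_def PiE_iff)
    have ea: "ext a \<in> configs n q"
      using x(1) q by (auto simp: ext_def a_def configs_def PiE_iff)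
    have "f (ext a) v = f x v" if v: "v \<in> {1..n}" "v \<notin> B" for v
    proof (rule functions_with_graph_cong[OF f ea x(1) v(1)])
      fix u assume "(u, v) \<in> parcs D"
      then have "u \<in> A" "u \<in> {1..n}"
        using cov v parcs_subset[OF D] unfolding arc_cover_def by blast+
      then show "ext a u = x u" by (simp add: ext_def a_def)
    qed
    then have "G (a, b) = z"
      using z x by (auto simp: G_def b_def fun_eq_iff configs_def PiE_iff extensional_def)
    then show "z \<in> G ` (?P \<times> ?Q)" using ab by (auto intro!: image_eqI[of _ _ "(a, b)"])
  qed
  moreover have "finite (?P \<times> ?Q)" using fin by (intro finite_cartesian_product finite_PiE) auto
  ultimately have "card (f ` configs n q) \<le> card (?P \<times> ?Q)"
    by (rule surj_card_le[rotated])
  also have "\<dots> = q ^ (card A + card B)"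
    using fin by (simp add: card_cartesian_product card_PiE power_add)
  finally show ?thesis .
qed

lemma ima_le_alpha1:
  assumes D: "pair_wf_digraph D" "pverts D = {1..n}" and q: "2 \<le> q"
    and f: "f \<in> functions_with_graph n D q"
  shows "ima n q f \<le> alpha1 D"
proof -
  obtain A B where AB: "arc_cover A B (parcs D)" "card A + card B \<le> alpha1 D"
    using alpha1_cover[OF finite_parcs[OF D]] by blast
  have "card (f ` configs n q) \<le> q ^ (card A + card B)"
    by (rule card_image_le_cover[OF D _ f AB(1)]) (use q in auto)
  also have "\<dots> \<le> q ^ alpha1 D" using AB q by (intro power_increasing) auto
  finally have "real (card (f ` configs n q)) \<le> real q ^ alpha1 D"
    by (metis of_nat_le_iff of_nat_power)
  moreover have "(\<lambda>i\<in>{1..n}. 0) \<in> configs n q" using q by (auto simp: configs_def)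
  then have "0 < card (f ` configs n q)" by (auto simp: card_gt_0_iff)
  ultimately have "ima n q f \<le> log q (real q ^ alpha1 D)"
    unfolding ima_def using q by (intro log_mono) auto
  also have "\<dots> = alpha1 D" using q by (simp add: log_nat_power)
  finally show ?thesis .
qed

subsection \<open>The collision bound\<close>

text \<open>Assigns the value \<open>c\<close> to coordinate \<open>v\<close> of \<open>f\<close> on all configurations that coordinate
  \<open>v\<close> cannot distinguish from \<open>x\<close>.\<close>

definition redirect ::
    "nat \<Rightarrow> nat pair_pre_digraph \<Rightarrow> nat \<Rightarrow> (nat \<Rightarrow> nat) \<Rightarrow> nat \<Rightarrow> ((nat \<Rightarrow> nat) \<Rightarrow> nat \<Rightarrow> nat)
      \<Rightarrow> nat \<Rightarrow> (nat \<Rightarrow> nat) \<Rightarrow> nat \<Rightarrow> nat" where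
  "redirect n D q x v f c = (\<lambda>z\<in>configs n q.
     if \<forall>u. (u, v) \<in> parcs D \<longrightarrow> z u = x u then (f z)(v := c) else f z)"

text \<open>Moving \<open>x\<close> along coordinate \<open>u\<close> leaves the redirected cell if \<open>u\<close> is an in-neighbour of
  \<open>v\<close>, so a value \<open>c\<close> different from the one found there keeps the dependence on \<open>u\<close>.\<close>

definition safe_values ::
    "nat \<Rightarrow> nat pair_pre_digraph \<Rightarrow> nat \<Rightarrow> (nat \<Rightarrow> nat) \<Rightarrow> nat \<Rightarrow> ((nat \<Rightarrow> nat) \<Rightarrow> nat \<Rightarrow> nat)
      \<Rightarrow> nat set" where
  "safe_values n D q x v f =
     {..<q} - (\<lambda>u. f (x(u := if x u = 0 then 1 else 0)) v) ` {1..n}"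

lemma card_safe_values: "q - n \<le> card (safe_values n D q x v f)"
proof -
  let ?B = "(\<lambda>u. f (x(u := if x u = 0 then 1 else 0)) v) ` {1..n}"
  have "card ?B \<le> n" using card_image_le[of "{1..n}"] by fastforce
  moreover have "card {..<q} - card ?B \<le> card ({..<q} - ?B)" by (rule diff_card_le_card_Diff) simp
  ultimately show ?thesis unfolding safe_values_def by simp
qed

text \<open>No dependence is created, since membership in the redirected cell is decided by the
  in-neighbours of \<open>v\<close> alone. None is lost, since a safe \<open>c\<close> differs from
  the untouched value at the shifted \<open>x\<close>.\<close>

lemma redirect_in_functions_with_graph:
  assumes D: "pair_wf_digraph D" "pverts D = {1..n}" and q: "2 \<le> q"
    and f: "f \<in> functions_with_graph n D q" and x: "x \<in> configs n q" and v: "v \<in> {1..n}"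
    and c: "c \<in> safe_values n D q x v f"
  shows "redirect n D q x v f c \<in> functions_with_graph n D q" (is "?g \<in> _")
proof -
  have N: "u \<in> {1..n}" if "(u, w) \<in> parcs D" for u w
    using that parcs_subset[OF D] by blast
  have fc: "f z \<in> configs n q" if "z \<in> configs n q" for z
    using f that by (auto simp: functions_with_graph_def)
  have dep: "(u, w) \<in> parcs D \<longleftrightarrow> depends_essentially n q f w u"
    if "u \<in> {1..n}" "w \<in> {1..n}" for u w
    using f that by (auto simp: functions_with_graph_def interaction_graph_def)
  have gv: "?g z v = (if \<forall>u. (u, v) \<in> parcs D \<longrightarrow> z u = x u then c else f z v)"
    if "z \<in> configs n q" for z
    unfolding redirect_def using that by (simp only: restrict_apply if_True if_distrib[of "\<lambda>h. h v"] fun_upd_same)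
  have gw: "?g z w = f z w" if "z \<in> configs n q" "w \<noteq> v" for z w
    using that by (simp add: redirect_def)
  have "depends_essentially n q ?g w u \<longleftrightarrow> (u, w) \<in> parcs D"
    if uw: "u \<in> {1..n}" "w \<in> {1..n}" for u w
  proof (cases "w = v")
    case False
    then show ?thesis
      using dep[OF uw] gw by (simp add: depends_essentially_def)
  next
    case True
    show ?thesis
    proof
      assume "(u, w) \<in> parcs D"
      then have arc: "(u, v) \<in> parcs D" using True by simp
      let ?y = "x(u := if x u = 0 then 1 else 0)"
      have y: "?y \<in> configs n q"
        using x q uw by (auto simp: configs_def PiE_iff extensional_def)
      have "?g x v = c" using gv[OF x] by simp
      moreover have "?g ?y v = f ?y v"
        using gv[OF y] arc by (metis fun_upd_same zero_neq_one)
      moreover have "c \<noteq> f ?y v" using c uw unfolding safe_values_def by blast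
      ultimately show "depends_essentially n q ?g w u"
        unfolding depends_essentially_def True
        by (intro bexI[OF _ x] bexI[OF _ y]) auto
    next
      assume "depends_essentially n q ?g w u"
      then obtain y z where yz: "y \<in> configs n q" "z \<in> configs n q"
        "\<And>i. i \<in> {1..n} \<Longrightarrow> i \<noteq> u \<Longrightarrow> y i = z i" "?g y v \<noteq> ?g z v"
        unfolding depends_essentially_def True by blast
      show "(u, w) \<in> parcs D"
      proof (rule ccontr)
        assume "(u, w) \<notin> parcs D"
        then have eq: "y i = z i" if "(i, v) \<in> parcs D" for i
          using that N yz(3) True by metis
        then have "f y v = f z v"
          using functions_with_graph_cong[OF f yz(1,2) v] by blast
        moreover have "(\<forall>i. (i, v) \<in> parcs D \<longrightarrow> y i = x i) \<longleftrightarrow> (\<forall>i. (i, v) \<in> parcs D \<longrightarrow> z i = x i)"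
          using eq by metis
        ultimately show False using yz(4) gv[OF yz(1)] gv[OF yz(2)] by (simp only: simp_thms)
      qed
    qed
  qed
  then have "interaction_graph n q ?g = D" using D by (intro interaction_graph_eqI)
  moreover have "?g z \<in> configs n q" if "z \<in> configs n q" for z
  proof -
    have "c < q" using c by (simp add: safe_values_def)
    then have "(f z)(v := c) \<in> configs n q"
      using fc[OF that] v by (simp add: configs_def PiE_iff extensional_def)
    then show ?thesis using fc[OF that] that by (simp add: redirect_def)
  qed
  then have "?g \<in> configs n q \<rightarrow>\<^sub>E configs n q"
    by (auto simp: redirect_def)
  ultimately show ?thesis by (simp add: functions_with_graph_def)
qed

text \<open>The overwritten value can be recovered: \<open>y\<close> lies outside the cell, so the
  value at \<open>y\<close> survives, and the collision says that it equals the old value at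
  \<open>x\<close>. That value is constant on the cell.\<close>

lemma redirect_inj:
  assumes f: "f \<in> functions_with_graph n D q" and g: "g \<in> functions_with_graph n D q"
    and x: "x \<in> configs n q" and y: "y \<in> configs n q" and v: "v \<in> {1..n}"
    and u: "(u, v) \<in> parcs D" "x u \<noteq> y u"
    and fxy: "f x v = f y v" and gxy: "g x v = g y v"
    and eq: "redirect n D q x v f c = redirect n D q x v g d"
  shows "f = g \<and> c = d"
proof
  have at: "redirect n D q x v f c z w = redirect n D q x v g d z w" for z w
    using eq by simp
  show "c = d" using at[of x v] x by (simp add: redirect_def)
  have "\<not> (\<forall>u. (u, v) \<in> parcs D \<longrightarrow> y u = x u)" using u by auto
  then have "f y v = g y v"
    using at[of y v] y unfolding redirect_def by (simp only: restrict_apply if_True if_False simp_thms)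
  then have xv: "f x v = g x v" using fxy gxy by simp
  have "f z w = g z w" if z: "z \<in> configs n q" for z w
  proof (cases "w = v \<and> (\<forall>u. (u, v) \<in> parcs D \<longrightarrow> z u = x u)")
    case True
    then show ?thesis
      using functions_with_graph_cong[OF f z x v] functions_with_graph_cong[OF g z x v] xv
      by auto
  next
    case False
    then show ?thesis using at[of z w] z by (auto simp: redirect_def split: if_splits)
  qed
  then have "f z = g z" if "z \<in> configs n q" for z using that by auto
  moreover have "f \<in> extensional (configs n q)" "g \<in> extensional (configs n q)"
    using f g by (auto simp: functions_with_graph_def PiE_iff)
  ultimately show "f = g" by (metis extensionalityI)
qed

text \<open>Redirecting one coordinate of \<open>f\<close> at \<open>x\<close> to any of at least \<open>q - n\<close> values destroys
  a collision there and keeps the interaction graph, so each imposed collision costs a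
  factor \<open>q - n\<close>.\<close>

lemma card_collisions:
  assumes D: "pair_wf_digraph D" "pverts D = {1..n}" and q: "2 \<le> q"
    and x: "x \<in> configs n q" and y: "y \<in> configs n q"
    and M: "finite M" "M \<subseteq> parcs D" "inj_on snd M" "\<And>e. e \<in> M \<Longrightarrow> x (fst e) \<noteq> y (fst e)"
  shows "(q - n) ^ card M * card {f \<in> functions_with_graph n D q. \<forall>e\<in>M. f x (snd e) = f y (snd e)}
    \<le> card (functions_with_graph n D q)"
  using M
proof (induction M)
  case empty
  then show ?case by simp
next
  case (insert e M)
  obtain u v where e: "e = (u, v)" by (cases e)
  define C where "C M = {f \<in> functions_with_graph n D q. \<forall>e\<in>M. f x (snd e) = f y (snd e)}"
    for M :: "(nat \<times> nat) set"
  have fin: "finite (C M')" for M' by (simp add: C_def)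
  have arc: "(u, v) \<in> parcs D" "x u \<noteq> y u" using insert.prems(1) insert.prems(3)[of e] e by auto
  then have v: "v \<in> {1..n}" using parcs_subset[OF D] by blast
  \<comment> \<open>Double counting: pairs of a colliding function and a safe value inject into the
    functions that need only collide along \<open>M\<close>.\<close>
  define S where "S = (SIGMA f:C (insert e M). safe_values n D q x v f)"
  have inj: "inj_on (\<lambda>(f, c). redirect n D q x v f c) S"
  proof (rule inj_onI, clarify)
    fix f c g d
    assume "(f, c) \<in> S" "(g, d) \<in> S" "redirect n D q x v f c = redirect n D q x v g d"
    then show "f = g \<and> c = d"
      using redirect_inj[of f n D q g x y v u c d] x y v arc by (auto simp: S_def C_def e)
  qed
  have sub: "(\<lambda>(f, c). redirect n D q x v f c) ` S \<subseteq> C M"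
  proof clarify
    fix f c assume fc: "(f, c) \<in> S"
    then have f: "f \<in> functions_with_graph n D q" "\<forall>e\<in>M. f x (snd e) = f y (snd e)"
      and c: "c \<in> safe_values n D q x v f" by (auto simp: S_def C_def)
    \<comment> \<open>Heads are distinct, so redirecting coordinate \<open>v\<close> leaves the
      collisions imposed by \<open>M\<close> intact.\<close>
    have "snd e' \<noteq> v" if "e' \<in> M" for e'
      using that insert.hyps insert.prems(2) e by (metis inj_on_def insertCI snd_conv)
    then show "redirect n D q x v f c \<in> C M"
      using redirect_in_functions_with_graph[OF D q f(1) x v c] f(2) x y
      by (auto simp: C_def redirect_def)
  qed
  have "(q - n) * card (C (insert e M)) = (\<Sum>f\<in>C (insert e M). q - n)" by simp
  also have "\<dots> \<le> (\<Sum>f\<in>C (insert e M). card (safe_values n D q x v f))"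
    by (intro sum_mono card_safe_values)
  also have "\<dots> = card S" unfolding S_def
    by (subst card_SigmaI) (auto simp: fin safe_values_def)
  also have "\<dots> \<le> card (C M)" using inj sub fin by (rule card_inj_on_le)
  finally have "(q - n) ^ card M * ((q - n) * card (C (insert e M))) \<le> (q - n) ^ card M * card (C M)"
    by (rule mult_left_mono) simp
  also have "\<dots> \<le> card (functions_with_graph n D q)"
    unfolding C_def using insert by (intro insert.IH) auto
  finally show ?case using insert.hyps by (simp add: C_def mult_ac)
qed

section \<open>From collision counts to image sizes\<close>

text \<open>Cauchy-Schwarz for the fibre sizes of \<open>h\<close>: they sum to
  \<open>card X\<close>, and their squares sum to the number of ordered colliding pairs, diagonal
  included.\<close>

lemma card_squared_le_image_mult_collisions:
  assumes "finite X"
  shows "(card X)\<^sup>2 \<le> card (h ` X) * card {(x, y) \<in> X \<times> X. h x = h y}"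
proof -
  define c where "c z = real (card {x\<in>X. h x = z})" for z
  have "real (card X) = (\<Sum>x\<in>X. 1)" by simp
  also have "\<dots> = (\<Sum>z\<in>h ` X. c z)"
    unfolding c_def using sum.image_gen[OF assms, of "\<lambda>_. 1::real" h] by simp
  finally have X: "real (card X) = (\<Sum>z\<in>h ` X. c z)" .
  have "{(x, y) \<in> X \<times> X. h x = h y} = (SIGMA x:X. {y\<in>X. h y = h x})" by auto
  then have "real (card {(x, y) \<in> X \<times> X. h x = h y}) = (\<Sum>x\<in>X. c (h x))"
    using assms by (simp add: card_SigmaI c_def)
  also have "\<dots> = (\<Sum>z\<in>h ` X. \<Sum>x\<in>{x\<in>X. h x = z}. c (h x))"
    by (rule sum.image_gen[OF assms])
  also have "\<dots> = (\<Sum>z\<in>h ` X. (c z)\<^sup>2)"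
    by (intro sum.cong) (auto simp: c_def power2_eq_square)
  finally have "(real (card X))\<^sup>2 \<le> real (card (h ` X)) * card {(x, y) \<in> X \<times> X. h x = h y}"
    using sum_squared_le_sum_of_squares[of c "h ` X"] X by (simp add: mult.commute)
  then show ?thesis by (simp only: of_nat_le_iff flip: of_nat_mult of_nat_power)
qed

text \<open>Inputs outside \<open>U\<close> are frozen at 0. A pair differing in d places of
  \<open>U\<close> collides for a fraction at most \<open>p ^ d\<close> of the functions; summing
  over \<open>y\<close> factorises over \<open>U\<close>, and the choice of \<open>x\<close>
  contributes \<open>q ^ card M\<close>.\<close>

lemma sum_collisions_le:
  fixes U :: "nat set" and n q :: nat
  defines "ext \<equiv> \<lambda>x. \<lambda>i\<in>{1..n}. if i \<in> U then x i else 0"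
  assumes D: "pair_wf_digraph D" "pverts D = {1..n}" and q: "2 * n + 2 \<le> q"
    and M: "M \<subseteq> parcs D" "pairwise independent_arcs M" and U: "U = fst ` M"
  shows "(\<Sum>f\<in>functions_with_graph n D q.
      real (card {(x, y) \<in> (U \<rightarrow>\<^sub>E {..<q}) \<times> (U \<rightarrow>\<^sub>E {..<q}). f (ext x) = f (ext y)}))
    \<le> card (functions_with_graph n D q) * (3 * real q) ^ card M"
proof -
  let ?F = "functions_with_graph n D q" and ?P = "U \<rightarrow>\<^sub>E {..<q}"
  define p where "p = 1 / real (q - n)"
  \<comment> \<open>The constant 3 comes from q - 1 <= 2(q - n), which the lower bound on
    \<open>q\<close> ensures.\<close>
  have p: "0 \<le> p" "1 + (real q - 1) * p \<le> 3"
    using q by (auto simp: p_def field_simps of_nat_diff)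
  have finM: "finite M" using M(1) finite_parcs[OF D] by (rule finite_subset)
  then have finU: "finite U" by (simp add: U)
  have UV: "U \<subseteq> {1..n}" using M(1) parcs_subset[OF D] U by auto
  have inj: "inj_on fst M" "inj_on snd M"
    using M(2) by (auto simp: inj_on_def pairwise_def independent_arcs_def)
  have cardU: "card U = card M" unfolding U by (rule card_image) (rule inj)
  have ext: "ext x \<in> configs n q" if "x \<in> ?P" for x
    using that UV q by (auto simp: ext_def configs_def PiE_iff)
  have coll: "real (card {f\<in>?F. f (ext x) = f (ext y)})
      \<le> card ?F * (\<Prod>u\<in>U. if x u = y u then 1 else p)"
    if xy: "x \<in> ?P" "y \<in> ?P" for x y
  proof -
    \<comment> \<open>Only arcs whose tail separates \<open>x\<close> from \<open>y\<close> yield a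
      saving. Tails are distinct, so there is one such arc for each place where they differ.\<close>
    define M' where "M' = {e\<in>M. x (fst e) \<noteq> y (fst e)}"
    let ?C = "{f\<in>?F. \<forall>e\<in>M'. f (ext x) (snd e) = f (ext y) (snd e)}"
    have ne: "ext x (fst e) \<noteq> ext y (fst e)" if "e \<in> M'" for e
    proof -
      have "fst e \<in> U" using that by (auto simp: M'_def U)
      then show ?thesis using that UV by (auto simp: ext_def M'_def)
    qed
    have "(q - n) ^ card M' * card ?C \<le> card ?F"
      by (rule card_collisions[OF D _ ext[OF xy(1)] ext[OF xy(2)] _ _ _ ne])
        (use q finM M(1) inj(2) in \<open>auto simp: M'_def intro: inj_on_subset\<close>)
    then have "real (q - n) ^ card M' * real (card ?C) \<le> real (card ?F)"
      by (simp only: of_nat_le_iff flip: of_nat_mult of_nat_power)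
    then have "real (card ?C) \<le> card ?F * p ^ card M'"
      using q by (simp add: p_def power_one_over field_simps)
    moreover have "card {f\<in>?F. f (ext x) = f (ext y)} \<le> card ?C"
      by (intro card_mono) auto
    moreover have "card M' = card {u\<in>U. x u \<noteq> y u}"
    proof -
      have "fst ` M' = {u\<in>U. x u \<noteq> y u}" by (auto simp: M'_def U)
      moreover have "inj_on fst M'" using inj(1) by (rule inj_on_subset) (auto simp: M'_def)
      ultimately show ?thesis by (metis card_image)
    qed
    moreover have "(\<Prod>u\<in>U. if x u = y u then 1 else p) = p ^ card {u\<in>U. x u \<noteq> y u}"
      using finU by (subst prod.If_cases) (auto intro!: arg_cong[where f = "\<lambda>A. p ^ card A"])
    ultimately show ?thesis by simp
  qed
  have row_sum: "(\<Sum>y\<in>?P. \<Prod>u\<in>U. if x u = y u then 1 else p) \<le> 3 ^ card M" if x: "x \<in> ?P" for x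
  proof -
    \<comment> \<open>The coordinates of \<open>y\<close> range independently, so the sum of
      products becomes a product of sums: one agreeing value and q - 1 others of weight
      \<open>p\<close>.\<close>
    have "(\<Sum>y\<in>?P. \<Prod>u\<in>U. if x u = y u then 1 else p) = (\<Prod>u\<in>U. \<Sum>b<q. if x u = b then 1 else p)"
      using finU by (subst prod_sum_PiE) auto
    also have "\<dots> = (\<Prod>u\<in>U. 1 + (real q - 1) * p)"
    proof (rule prod.cong[OF refl])
      fix u assume "u \<in> U"
      then have "x u \<in> {..<q}" using x by auto
      then have "(\<Sum>b<q. if x u = b then 1 else p) = 1 + (\<Sum>b\<in>{..<q} - {x u}. if x u = b then 1 else p)"
        by (subst sum.remove[of _ "x u"]) auto
      also have "(\<Sum>b\<in>{..<q} - {x u}. if x u = b then 1 else p) = (\<Sum>b\<in>{..<q} - {x u}. p)"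
        by (intro sum.cong) auto
      also have "\<dots> = (real q - 1) * p"
        using \<open>x u \<in> {..<q}\<close> by (simp add: of_nat_diff)
      finally show "(\<Sum>b<q. if x u = b then 1 else p) = 1 + (real q - 1) * p" .
    qed
    also have "\<dots> \<le> 3 ^ card M"
      using p q cardU by (simp add: power_mono)
    finally show ?thesis .
  qed
  have finP: "finite ?P" using finU by (intro finite_PiE) auto
  have "(\<Sum>f\<in>?F. real (card {(x, y) \<in> ?P \<times> ?P. f (ext x) = f (ext y)}))
      = (\<Sum>f\<in>?F. \<Sum>x\<in>?P. \<Sum>y\<in>?P. of_bool (f (ext x) = f (ext y)))"
  proof (rule sum.cong[OF refl])
    fix f
    have "{(x, y) \<in> ?P \<times> ?P. f (ext x) = f (ext y)} = (SIGMA x:?P. {y\<in>?P. f (ext x) = f (ext y)})"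
      by auto
    then show "real (card {(x, y) \<in> ?P \<times> ?P. f (ext x) = f (ext y)})
        = (\<Sum>x\<in>?P. \<Sum>y\<in>?P. of_bool (f (ext x) = f (ext y)))"
      using finP by (simp add: card_SigmaI sum_of_bool_eq Int_def)
  qed
  also have "\<dots> = (\<Sum>x\<in>?P. \<Sum>f\<in>?F. \<Sum>y\<in>?P. of_bool (f (ext x) = f (ext y)))"
    by (rule sum.swap)
  also have "\<dots> = (\<Sum>x\<in>?P. \<Sum>y\<in>?P. \<Sum>f\<in>?F. of_bool (f (ext x) = f (ext y)))"
    by (intro sum.cong refl sum.swap)
  also have "\<dots> = (\<Sum>x\<in>?P. \<Sum>y\<in>?P. real (card {f\<in>?F. f (ext x) = f (ext y)}))"
    by (intro sum.cong refl) (simp add: sum_of_bool_eq Int_def)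
  also have "\<dots> \<le> (\<Sum>x\<in>?P. \<Sum>y\<in>?P. card ?F * (\<Prod>u\<in>U. if x u = y u then 1 else p))"
    by (intro sum_mono coll)
  also have "\<dots> = (\<Sum>x\<in>?P. card ?F * (\<Sum>y\<in>?P. \<Prod>u\<in>U. if x u = y u then 1 else p))"
    by (simp add: sum_distrib_left)
  also have "\<dots> \<le> (\<Sum>x\<in>?P. real (card ?F) * 3 ^ card M)"
    by (intro sum_mono mult_left_mono row_sum) auto
  also have "\<dots> = card ?F * (3 * real q) ^ card M"
    using finU cardU by (simp add: card_PiE power_mult_distrib)
  finally show ?thesis .
qed

section \<open>The lower bound on the average and the limit\<close>

text \<open>Each \<open>f\<close> satisfies 2k ln q <= ln |Im f| + ln (t f), and \<open>t f\<close>
  averages at most c = (3q)^k. The loss against \<open>k\<close> is therefore k ln 3 / ln q.\<close>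

lemma average_ima_ge:
  assumes D: "pair_wf_digraph D" "pverts D = {1..n}" and q: "2 * n + 2 \<le> q"
  shows "card (functions_with_graph n D q) * (alpha1 D - alpha1 D * ln 3 / ln q)
    \<le> (\<Sum>f\<in>functions_with_graph n D q. ima n q f)"
proof -
  let ?F = "functions_with_graph n D q"
  define k where "k = alpha1 D"
  obtain M where M: "M \<subseteq> parcs D" "pairwise independent_arcs M" "card M = k"
    using alpha1_attained[OF finite_parcs[OF D]] unfolding k_def .
  define U where "U = fst ` M"
  define ext where "ext = (\<lambda>x. \<lambda>i\<in>{1..n}. if i \<in> U then x i else 0 :: nat)"
  let ?P = "U \<rightarrow>\<^sub>E {..<q}"
  define t where "t f = real (card {(x, y) \<in> ?P \<times> ?P. f (ext x) = f (ext y)})"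
    for f :: "(nat \<Rightarrow> nat) \<Rightarrow> nat \<Rightarrow> nat"
  define c where "c = (3 * real q) ^ k"
  have q0: "0 < q" "0 < ln (real q)" using q by auto
  have c0: "0 < c" using q0 by (simp add: c_def)
  have lnc: "ln c = k * ln 3 + k * ln q"
    using q0 by (simp add: c_def ln_realpow ln_mult algebra_simps)
  have finM: "finite M" using M(1) finite_parcs[OF D] by (rule finite_subset)
  then have finU: "finite U" by (simp add: U_def)
  have finP: "finite ?P" using finU by (intro finite_PiE) auto
  have "inj_on fst M"
    using M(2) by (auto simp: inj_on_def pairwise_def independent_arcs_def)
  then have "card U = k" using M(3) by (simp add: U_def card_image)
  then have cardP: "card ?P = q ^ k" using finU by (simp add: card_PiE)
  have UV: "U \<subseteq> {1..n}" using M(1) parcs_subset[OF D] U_def by auto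
  have ext: "ext x \<in> configs n q" if "x \<in> ?P" for x
    using that UV q0 by (auto simp: ext_def configs_def PiE_iff)
  have sum_t: "(\<Sum>f\<in>?F. t f) \<le> card ?F * c"
    using sum_collisions_le[OF D q M(1,2) U_def] M(3) unfolding t_def c_def ext_def by simp
  have ima: "k * ln q - k * ln 3 + 1 - t f / c \<le> ima n q f * ln q" if "f \<in> ?F" for f
  proof -
    let ?I = "card (f ` configs n q)"
    have "(q ^ k)\<^sup>2 \<le> card ((\<lambda>x. f (ext x)) ` ?P) * card {(x, y) \<in> ?P \<times> ?P. f (ext x) = f (ext y)}"
      using card_squared_le_image_mult_collisions[OF finP, of "\<lambda>x. f (ext x)"] cardP by simp
    \<comment> \<open>The padded inputs are only some of the configurations, so their image is part
      of the whole image.\<close>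
    also have "\<dots> \<le> ?I * card {(x, y) \<in> ?P \<times> ?P. f (ext x) = f (ext y)}"
      using ext by (intro mult_right_mono card_mono) auto
    finally have le: "(real q ^ k)\<^sup>2 \<le> real ?I * t f"
      unfolding t_def by (simp only: of_nat_le_iff flip: of_nat_mult of_nat_power)
    have "0 < (real q ^ k)\<^sup>2" using q0 by simp
    then have "0 < real ?I * t f" using le by linarith
    then have pos: "0 < real ?I" "0 < t f"
      by (auto simp: zero_less_mult_iff t_def)
    have "2 * (k * ln q) = ln ((real q ^ k)\<^sup>2)" using q0 by (simp add: ln_realpow)
    also have "\<dots> \<le> ln (real ?I * t f)" using le q0 by (intro ln_mono) auto
    also have "\<dots> = ln (real ?I) + ln (t f)" by (rule ln_mult_pos) (use pos in auto)
    finally have "2 * (k * ln q) \<le> ln (real ?I) + ln (t f)" .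
    moreover have "ln (t f) - ln c \<le> t f / c - 1"
      using ln_le_minus_one[of "t f / c"] pos c0 by (simp add: ln_div)
    moreover have "ima n q f * ln q = ln (real ?I)"
      using q0 by (simp add: ima_def log_def)
    ultimately show ?thesis using lnc by simp
  qed
  \<comment> \<open>The terms \<open>1 - t f / c\<close> come from linearising \<open>ln\<close> at \<open>c\<close>; they replace Jensen's
    inequality, their sum being nonnegative by \<open>sum_t\<close>.\<close>
  have "card ?F * (k * ln q - k * ln 3) \<le> card ?F * (k * ln q - k * ln 3) + (card ?F - (\<Sum>f\<in>?F. t f) / c)"
    using sum_t c0 by (simp add: pos_divide_le_eq)
  also have "\<dots> = (\<Sum>f\<in>?F. k * ln q - k * ln 3 + 1 - t f / c)"
    by (simp add: sum.distrib sum_subtractf sum_divide_distrib algebra_simps)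
  also have "\<dots> \<le> (\<Sum>f\<in>?F. ima n q f * ln q)" by (intro sum_mono ima)
  also have "\<dots> = (\<Sum>f\<in>?F. ima n q f) * ln q" by (simp add: sum_distrib_right)
  finally have "card ?F * (k * ln q - k * ln 3) / ln q \<le> (\<Sum>f\<in>?F. ima n q f)"
    using q0 by (simp add: pos_divide_le_eq)
  moreover have "card ?F * (k * ln q - k * ln 3) / ln q = card ?F * (k - k * ln 3 / ln q)"
    using q0 by (simp add: field_simps)
  ultimately show ?thesis by (simp add: k_def)
qed

theorem theorem4:
  fixes n :: nat and D :: "nat pair_pre_digraph"
  assumes "pair_wf_digraph D" and "pverts D = {1..n}"
  shows "(\<lambda>q. 1 / real (card (functions_with_graph n D q)) *
            (\<Sum>f\<in>functions_with_graph n D q. ima n q f))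
         \<longlonglongrightarrow> real (alpha1 D)"
proof (rule tendsto_sandwich)
  \<comment> \<open>Beyond this threshold the average is a genuine one and both bounds
    apply.\<close>
  have pos: "0 < card (functions_with_graph n D q)" if "2 * n + 2 \<le> q" for q
    using functions_with_graph_nonempty[OF assms, of q] that by (simp add: card_gt_0_iff)
  show "\<forall>\<^sub>F q in sequentially. real (alpha1 D) - alpha1 D * ln 3 / ln q
      \<le> 1 / card (functions_with_graph n D q) * (\<Sum>f\<in>functions_with_graph n D q. ima n q f)"
    using eventually_ge_at_top[of "2 * n + 2"]
  proof eventually_elim
    case (elim q)
    then show ?case
      using average_ima_ge[OF assms elim] pos[OF elim] by (simp add: field_simps)
  qed
  show "\<forall>\<^sub>F q in sequentially.
      1 / card (functions_with_graph n D q) * (\<Sum>f\<in>functions_with_graph n D q. ima n q f) \<le> alpha1 D"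
    using eventually_ge_at_top[of "2 * n + 2"]
  proof eventually_elim
    case (elim q)
    have "(\<Sum>f\<in>functions_with_graph n D q. ima n q f) \<le> card (functions_with_graph n D q) * real (alpha1 D)"
      by (rule sum_bounded_above) (use ima_le_alpha1[OF assms] elim in auto)
    then show ?case using pos[OF elim] by (simp add: field_simps)
  qed
  \<comment> \<open>The gap between the two bounds is a constant over ln q, so it vanishes.\<close>
  have "filterlim (\<lambda>q. ln (real q)) at_top sequentially"
    by (rule filterlim_compose[OF ln_at_top filterlim_real_sequentially])
  then have "(\<lambda>q. alpha1 D * ln 3 / ln (real q)) \<longlonglongrightarrow> 0"
    by (rule tendsto_divide_0[OF tendsto_const filterlim_at_top_imp_at_infinity])
  then show "(\<lambda>q. real (alpha1 D) - alpha1 D * ln 3 / ln (real q)) \<longlonglongrightarrow> alpha1 D"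
    using tendsto_diff[OF tendsto_const] by fastforce
qed simp

end
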